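(* Every $3$-edge path in an edge-transitive graph closes to a cycle.
   Context: Graphs are finite, simple, undirected, with non-empty vertex set. A path has pairwise distinct vertices and is not required to be induced. A graph $G$ is edge-transitive if for any two edges $e,f\in E(G)$ there is an automorphism of $G$ mapping $e$ to $f$. A path in $G$ closes to a cycle if there is a (not necessarily induced) cycle of $G$ that contains the path as a subpath. *)

theory Defs
  imports Graph_Theory.Graph_Theory
begin

(* Finite simple undirected graphs are rendered by the locale pair_graph: each undirected
   edge {u,v} is represented by the two arcs (u,v) and (v,u), and there are no loops. *)

definition und_edges :: "('a \<times> 'a) set \<Rightarrow> 'a set set" where
  "und_edges A = (\<lambda>(u, v). {u, v}) ` A"

definition graph_automorphism ::
    "'a pair_pre_digraph \<Rightarrow> ('a, 'a \<times> 'a, 'a, 'a \<times> 'a) digraph_isomorphism \<Rightarrow> bool" where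
  "graph_automorphism G h \<longleftrightarrow>
     pre_digraph.digraph_isomorphism (with_proj G) h \<and> app_iso h (with_proj G) = with_proj G"

(* Edges are compared as unordered pairs, so an automorphism may map the ends of e to the
   ends of f in either order (edge-transitivity, not arc-transitivity). *)
definition edge_transitive :: "'a pair_pre_digraph \<Rightarrow> bool" where
  "edge_transitive G \<longleftrightarrow>
     (\<forall>e \<in> und_edges (parcs G). \<forall>f \<in> und_edges (parcs G).
        \<exists>h. graph_automorphism G h \<and> iso_verts h ` e = f)"

(* The bound 3 excludes the closed walks u, v, u along a single undirected edge, which
   pre_digraph.cycle admits. *)
definition und_cycle :: "'a pair_pre_digraph \<Rightarrow> ('a \<times> 'a) awalk \<Rightarrow> bool" where
  "und_cycle G c \<longleftrightarrow> pre_digraph.cycle (with_proj G) c \<and> 3 \<le> length c"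

(* The path p starting at u is a subgraph of some cycle c of G, regardless of orientation.
   As c is closed, its vertices are the tails of its arcs. *)
definition closes_to_cycle :: "'a pair_pre_digraph \<Rightarrow> 'a \<Rightarrow> ('a \<times> 'a) awalk \<Rightarrow> bool" where
  "closes_to_cycle G u p \<longleftrightarrow>
     (\<exists>c. und_cycle G c \<and>
          set (pawalk_verts u p) \<subseteq> fst ` set c \<and>
          und_edges (set p) \<subseteq> und_edges (set c))"

(* Agreement with the usual description by permutations of the vertices. *)
lemma (in pair_graph) graph_automorphism_iff_bij:
  "(\<exists>h. graph_automorphism G h \<and> iso_verts h = \<phi>) \<longleftrightarrow>
     bij_betw \<phi> (pverts G) (pverts G) \<and>
     (\<forall>u \<in> pverts G. \<forall>v \<in> pverts G. (\<phi> u, \<phi> v) \<in> parcs G \<longleftrightarrow> (u, v) \<in> parcs G)"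
  (is "?L \<longleftrightarrow> ?R")
proof
  assume ?L
  then obtain h where h: "pre_digraph.digraph_isomorphism (with_proj G) h"
    "app_iso h (with_proj G) = with_proj G" "iso_verts h = \<phi>"
    by (auto simp: graph_automorphism_def)
  have V: "\<phi> ` pverts G = pverts G" and A: "iso_arcs h ` parcs G = parcs G"
    and t: "iso_tail h = fst" and hd: "iso_head h = snd"
    using h(2,3) by (auto simp: app_iso_def with_proj_def)
  have inj: "inj_on \<phi> (pverts G)"
    using h(1,3) by (simp add: pre_digraph.digraph_isomorphism_def)
  have arc: "iso_arcs h (u, v) = (\<phi> u, \<phi> v)" if "(u, v) \<in> parcs G" for u v
  proof -
    have "\<phi> u = fst (iso_arcs h (u, v)) \<and> \<phi> v = snd (iso_arcs h (u, v))"
      using h(1) that unfolding pre_digraph.digraph_isomorphism_def h(3) t hd by auto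
    then show ?thesis by simp
  qed
  have "(\<phi> u, \<phi> v) \<in> parcs G \<longleftrightarrow> (u, v) \<in> parcs G" if uv: "u \<in> pverts G" "v \<in> pverts G" for u v
  proof
    assume "(u, v) \<in> parcs G"
    then show "(\<phi> u, \<phi> v) \<in> parcs G" using A arc by (metis imageI)
  next
    assume "(\<phi> u, \<phi> v) \<in> parcs G"
    then obtain x y where xy: "(x, y) \<in> parcs G" "(\<phi> x, \<phi> y) = (\<phi> u, \<phi> v)"
      using A arc by (metis imageE surj_pair)
    then have "x = u" "y = v"
      using inj uv wellformed'[OF xy(1)] xy(2) by (simp_all add: inj_on_def)
    then show "(u, v) \<in> parcs G" using xy by simp
  qed
  then show ?R using inj V by (auto simp: bij_betw_def)
next
  assume R: ?R
  define h where "h = \<lparr> iso_verts = \<phi>, iso_arcs = map_prod \<phi> \<phi>,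
    iso_head = (snd :: 'a \<times> 'a \<Rightarrow> 'a), iso_tail = (fst :: 'a \<times> 'a \<Rightarrow> 'a) \<rparr>"
  have inj: "inj_on \<phi> (pverts G)" and V: "\<phi> ` pverts G = pverts G"
    using R by (auto simp: bij_betw_def)
  have sub: "parcs G \<subseteq> pverts G \<times> pverts G" using wellformed' by auto
  have "inj_on (map_prod \<phi> \<phi>) (parcs G)"
    using sub by (intro inj_on_subset[OF map_prod_inj_on[OF inj inj]])
  moreover have "map_prod \<phi> \<phi> ` parcs G = parcs G"
  proof
    show "map_prod \<phi> \<phi> ` parcs G \<subseteq> parcs G" using R sub by auto
    show "parcs G \<subseteq> map_prod \<phi> \<phi> ` parcs G"
    proof clarify
      fix a b assume ab: "(a, b) \<in> parcs G"
      then have "a \<in> \<phi> ` pverts G" "b \<in> \<phi> ` pverts G"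
        using wellformed' by (simp_all add: V)
      then obtain x y where xy: "x \<in> pverts G" "y \<in> pverts G" "a = \<phi> x" "b = \<phi> y"
        by (elim imageE)
      then have "(x, y) \<in> parcs G" using R ab by simp
      then show "(a, b) \<in> map_prod \<phi> \<phi> ` parcs G"
        using xy by (intro image_eqI[of _ _ "(x, y)"]) simp_all
    qed
  qed
  ultimately have "graph_automorphism G h"
    using inj V wf_digraph
    by (simp add: graph_automorphism_def h_def pre_digraph.digraph_isomorphism_def
        app_iso_def with_proj_def)
  then show ?L by (auto simp: h_def)
qed

end

(* If the path a, b, c, d does not close to a cycle, then {b, c} separates a from d, so by
   edge-transitivity the ends of every edge form a separator. There are no cut vertices: a
   minimal side of a cut vertex would contain an edge with a cut vertex as an end, hence a
   smaller side, or a leaf, and then every edge would have a leaf as an end, unlike bc. Now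
   choose an edge xy and a side K of its separator with K minimal, and a neighbour z of x in
   K. The separator {x, z} has two sides, and the one avoiding y leaves a smaller side inside
   K, a contradiction. *)

theory Submission
  imports Defs
begin

context pair_graph
begin

section \<open>Sides of cut vertices and of separating edges\<close>

text \<open>In \<open>cut x Y\<close> and \<open>sep x y K\<close> the sets \<open>Y\<close> and \<open>K\<close> are unions of components of
  the graph minus \<open>x\<close> or minus \<open>x\<close> and \<open>y\<close>. The remaining conditions say that the deleted
  vertices have neighbours on both sides, which makes sense in disconnected graphs too.\<close>

definition cut :: "'a \<Rightarrow> 'a set \<Rightarrow> bool" where
  "cut x Y \<longleftrightarrow> Y \<subseteq> pverts G \<and> x \<notin> Y \<and> parcs G `` Y \<subseteq> insert x Y \<and>
     parcs G `` {x} \<inter> Y \<noteq> {} \<and> \<not> parcs G `` {x} \<subseteq> Y"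

definition sep :: "'a \<Rightarrow> 'a \<Rightarrow> 'a set \<Rightarrow> bool" where
  "sep x y K \<longleftrightarrow> K \<subseteq> pverts G \<and> x \<notin> K \<and> y \<notin> K \<and> parcs G `` K \<subseteq> insert x (insert y K) \<and>
     parcs G `` {x} \<inter> K \<noteq> {} \<and> parcs G `` {y} \<inter> K \<noteq> {} \<and>
     \<not> parcs G `` {x} \<subseteq> insert y K \<and> \<not> parcs G `` {y} \<subseteq> insert x K"

lemma sep_commute: "sep x y K \<longleftrightarrow> sep y x K"
  by (auto simp: sep_def insert_commute)

lemma arc_commute: "(x, y) \<in> parcs G \<longleftrightarrow> (y, x) \<in> parcs G"
  by (auto intro: arcs_symmetric)

lemma arc_distinct: "(x, y) \<in> parcs G \<Longrightarrow> x \<noteq> y"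
  using pair_no_loops by fastforce

text \<open>Without cut vertices two of the four neighbour conditions come for free. If
  \<open>y\<close> had no neighbour in \<open>K\<close>, then \<open>K\<close> would be a side of
  the cut vertex \<open>x\<close>; if all neighbours of \<open>x\<close> lay in \<open>K\<close> or
  were \<open>y\<close>, then \<open>K\<close> together with \<open>x\<close> would be a side of the
  cut vertex \<open>y\<close>.\<close>

lemma sep_of_no_cut:
  assumes no_cut: "\<And>x Y. \<not> cut x Y"
    and xy: "(x, y) \<in> parcs G"
    and K: "K \<subseteq> pverts G" "x \<notin> K" "y \<notin> K" "parcs G `` K \<subseteq> insert x (insert y K)"
    and nbrs: "parcs G `` {x} \<inter> K \<noteq> {}" "\<not> parcs G `` {y} \<subseteq> insert x K"
  shows "sep x y K"
proof -
  have ne: "x \<noteq> y" using xy by (rule arc_distinct)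
  have "parcs G `` {y} \<inter> K \<noteq> {}"
  proof
    assume *: "parcs G `` {y} \<inter> K = {}"
    then have "parcs G `` K \<subseteq> insert x K" using K arc_commute by blast
    then have "cut x K" using nbrs(1) xy K by (auto simp: cut_def)
    then show False using no_cut by blast
  qed
  moreover have "\<not> parcs G `` {x} \<subseteq> insert y K"
  proof
    assume *: "parcs G `` {x} \<subseteq> insert y K"
    have "parcs G `` insert x K \<subseteq> insert y (insert x K)" using K * by blast
    moreover have "x \<in> pverts G" using xy wellformed' by blast
    moreover have "x \<in> parcs G `` {y}" using xy arc_commute by blast
    ultimately have "cut y (insert x K)"
      using nbrs(2) K ne unfolding cut_def by blast
    then show False using no_cut by blast
  qed
  ultimately show ?thesis using assms by (simp add: sep_def)
qed

section \<open>Transport along automorphisms\<close>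

lemma automorphism_image_arcs:
  assumes bij: "bij_betw \<phi> (pverts G) (pverts G)"
    and arcs: "\<And>u v. u \<in> pverts G \<Longrightarrow> v \<in> pverts G \<Longrightarrow>
      (\<phi> u, \<phi> v) \<in> parcs G \<longleftrightarrow> (u, v) \<in> parcs G"
    and S: "S \<subseteq> pverts G"
  shows "parcs G `` (\<phi> ` S) = \<phi> ` (parcs G `` S)"
proof
  show "\<phi> ` (parcs G `` S) \<subseteq> parcs G `` (\<phi> ` S)"
    using arcs wellformed' by blast
  show "parcs G `` (\<phi> ` S) \<subseteq> \<phi> ` (parcs G `` S)"
  proof
    fix t assume "t \<in> parcs G `` (\<phi> ` S)"
    then obtain s where s: "s \<in> S" "(\<phi> s, t) \<in> parcs G" by blast
    then have "t \<in> \<phi> ` pverts G"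
      using wellformed' bij by (metis bij_betw_imp_surj_on)
    then obtain r where "r \<in> pverts G" "t = \<phi> r" by blast
    then show "t \<in> \<phi> ` (parcs G `` S)" using s arcs S by blast
  qed
qed

text \<open>Both notions are built from membership, inclusion and disjointness of vertex sets and
  neighbourhoods; an automorphism preserves and reflects all of these.\<close>

lemma
  assumes bij: "bij_betw \<phi> (pverts G) (pverts G)"
    and arcs: "\<And>u v. u \<in> pverts G \<Longrightarrow> v \<in> pverts G \<Longrightarrow>
      (\<phi> u, \<phi> v) \<in> parcs G \<longleftrightarrow> (u, v) \<in> parcs G"
    and x: "x \<in> pverts G"
  shows cut_automorphism: "cut x Y \<Longrightarrow> cut (\<phi> x) (\<phi> ` Y)"
    and sep_automorphism: "y \<in> pverts G \<Longrightarrow> sep x y Y \<Longrightarrow> sep (\<phi> x) (\<phi> y) (\<phi> ` Y)"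
proof -
  note img = automorphism_image_arcs[OF bij arcs]
  have inj: "inj_on \<phi> (pverts G)" and V: "\<phi> ` pverts G = pverts G"
    using bij by (auto simp: bij_betw_def)
  have sub: "parcs G `` S \<subseteq> pverts G" for S using wellformed' by blast
  have nbr: "parcs G `` {\<phi> z} = \<phi> ` (parcs G `` {z})" if "z \<in> pverts G" for z
    using img[of "{z}"] that by simp
  have mem: "\<phi> z \<in> \<phi> ` S \<longleftrightarrow> z \<in> S" if "z \<in> pverts G" "S \<subseteq> pverts G" for z S
    using inj_on_image_mem_iff[OF inj] that by blast
  have subset: "\<phi> ` S \<subseteq> \<phi> ` T \<longleftrightarrow> S \<subseteq> T" if "S \<subseteq> pverts G" "T \<subseteq> pverts G" for S T
    using mem that by blast
  have int: "\<phi> ` S \<inter> \<phi> ` T = {} \<longleftrightarrow> S \<inter> T = {}" if "S \<subseteq> pverts G" "T \<subseteq> pverts G" for S T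
    using inj_on_image_Int[OF inj that] by (metis image_is_empty)
  show "cut (\<phi> x) (\<phi> ` Y)" if cut: "cut x Y"
  proof -
    have Y: "Y \<subseteq> pverts G" "insert x Y \<subseteq> pverts G" using cut x by (auto simp: cut_def)
    have "\<phi> ` Y \<subseteq> pverts G" using Y V by blast
    then show ?thesis
      using cut Y
      by (simp add: cut_def img nbr[OF x] mem[OF x] subset[OF sub] int[OF sub] del: image_insert insert_subset
          flip: image_insert)
  qed
  show "sep (\<phi> x) (\<phi> y) (\<phi> ` Y)" if y: "y \<in> pverts G" and sep: "sep x y Y"
  proof -
    have Y: "Y \<subseteq> pverts G" "insert x Y \<subseteq> pverts G" "insert y Y \<subseteq> pverts G"
      "insert x (insert y Y) \<subseteq> pverts G"
      using sep x y by (auto simp: sep_def)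
    have "\<phi> ` Y \<subseteq> pverts G" using Y V by blast
    then show ?thesis
      using sep Y
      by (simp add: sep_def img nbr[OF x] nbr[OF y] mem[OF x] mem[OF y] subset[OF sub]
          int[OF sub] del: image_insert insert_subset flip: image_insert)
  qed
qed

lemma edge_transitive_automorphism:
  assumes "edge_transitive G" "(x, y) \<in> parcs G" "(u, v) \<in> parcs G"
  obtains \<phi> where "bij_betw \<phi> (pverts G) (pverts G)"
    and "\<And>s t. s \<in> pverts G \<Longrightarrow> t \<in> pverts G \<Longrightarrow> (\<phi> s, \<phi> t) \<in> parcs G \<longleftrightarrow> (s, t) \<in> parcs G"
    and "\<phi> x = u \<and> \<phi> y = v \<or> \<phi> x = v \<and> \<phi> y = u"
proof -
  have "{x, y} \<in> und_edges (parcs G)" "{u, v} \<in> und_edges (parcs G)"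
    using assms by (auto simp: und_edges_def)
  then obtain h where h: "graph_automorphism G h" "iso_verts h ` {x, y} = {u, v}"
    using assms(1) unfolding edge_transitive_def by blast
  then show ?thesis
    using that[of "iso_verts h"] graph_automorphism_iff_bij[of "iso_verts h"]
    by (auto simp: doubleton_eq_iff)
qed

text \<open>A cut vertex has a neighbour, so it is an end of some edge. An automorphism taking that
  edge to \<open>{u, v}\<close> turns it into \<open>u\<close> or \<open>v\<close>; which of the two
  is not controlled.\<close>

lemma edge_transitive_cut:
  assumes "edge_transitive G" "cut x Y" "(u, v) \<in> parcs G"
  shows "\<exists>Z. cut u Z \<or> cut v Z"
proof -
  obtain y where y: "(x, y) \<in> parcs G" using assms(2) by (auto simp: cut_def)
  then have "x \<in> pverts G" using wellformed' by blast
  with edge_transitive_automorphism[OF assms(1) y assms(3)] show ?thesis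
    using cut_automorphism[OF _ _ _ assms(2)] by metis
qed

text \<open>Here the orientation chosen by the automorphism does not matter, because
  \<open>sep\<close> is symmetric in the deleted vertices.\<close>

lemma edge_transitive_sep:
  assumes "edge_transitive G" "(x, y) \<in> parcs G" "sep x y K" "(u, v) \<in> parcs G"
  shows "\<exists>L. sep u v L"
proof -
  have "x \<in> pverts G" "y \<in> pverts G" using assms(2) wellformed' by blast+
  with edge_transitive_automorphism[OF assms(1,2,4)] show ?thesis
    using sep_automorphism[OF _ _ _ _ assms(3)] sep_commute by metis
qed

lemma edge_transitive_leaf:
  assumes "edge_transitive G" "(x, w) \<in> parcs G" "parcs G `` {w} \<subseteq> {x}" "(u, v) \<in> parcs G"
  shows "parcs G `` {u} \<subseteq> {v} \<or> parcs G `` {v} \<subseteq> {u}"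
proof -
  have V: "x \<in> pverts G" "w \<in> pverts G" using assms(2) wellformed' by blast+
  obtain \<phi> where \<phi>: "bij_betw \<phi> (pverts G) (pverts G)"
    "\<And>s t. s \<in> pverts G \<Longrightarrow> t \<in> pverts G \<Longrightarrow> (\<phi> s, \<phi> t) \<in> parcs G \<longleftrightarrow> (s, t) \<in> parcs G"
    "\<phi> x = u \<and> \<phi> w = v \<or> \<phi> x = v \<and> \<phi> w = u"
    using edge_transitive_automorphism[OF assms(1,2,4)] by metis
  have "parcs G `` {\<phi> w} = \<phi> ` (parcs G `` {w})"
    using automorphism_image_arcs[OF \<phi>(1,2), of "{w}"] V by simp
  then have "parcs G `` {\<phi> w} \<subseteq> {\<phi> x}" using assms(3) by blast
  then show ?thesis using \<phi>(3) by auto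
qed

section \<open>Absence of cut vertices and of separating edges\<close>

text \<open>The last two assumptions say that neither \<open>b\<close> nor \<open>c\<close> is a
  leaf. The induction on \<open>card Y\<close> plays the role of choosing a minimal side.\<close>

lemma edge_transitive_no_cut:
  assumes et: "edge_transitive G" and bc: "(b, c) \<in> parcs G"
    and b: "\<not> parcs G `` {b} \<subseteq> {c}" and c: "\<not> parcs G `` {c} \<subseteq> {b}"
  shows "\<not> cut x Y"
proof
  assume "cut x Y"
  have fin: "finite Y" if "cut x Y" for x Y
    using that finite_subset[OF _ pair_finite_verts] by (simp add: cut_def)
  from \<open>cut x Y\<close> show False
  proof (induction "card Y" arbitrary: x Y rule: less_induct)
    case less
    have Y: "Y \<subseteq> pverts G" "x \<notin> Y" "parcs G `` Y \<subseteq> insert x Y"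
      using less.prems by (auto simp: cut_def)
    have smaller: "\<not> cut w Z" if "Z \<subset> Y" for w Z
      using less.hyps that fin[OF less.prems] psubset_card_mono by blast
    \<comment> \<open>A cut vertex \<open>w\<close> in \<open>Y\<close> has two sides,
      \<open>Z\<close> and the rest. The one avoiding \<open>x\<close> cannot leave \<open>Y\<close>
      through \<open>x\<close>, so its part in \<open>Y\<close> is a side of \<open>w\<close>,
      smaller than \<open>Y\<close> as it omits \<open>w\<close>.\<close>
    have inside: "\<not> cut w Z" if w: "w \<in> Y" for w Z
    proof
      assume cut: "cut w Z"
      then obtain s t where s: "(w, s) \<in> parcs G" "s \<in> Z" and t: "(w, t) \<in> parcs G" "t \<notin> Z"
        by (auto simp: cut_def)
      have Z: "w \<notin> Z" "parcs G `` Z \<subseteq> insert w Z" using cut by (auto simp: cut_def)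
      have wt: "w \<noteq> t" using t arc_distinct by blast
      have st: "s \<in> insert x Y" "t \<in> insert x Y" using Y w s t by blast+
      show False
      proof (cases "x \<in> Z")
        case False
        have "parcs G `` (Y \<inter> Z) \<subseteq> insert w (Y \<inter> Z)" using Y Z False by blast
        moreover have "s \<in> Y" using s st False by blast
        ultimately have "cut w (Y \<inter> Z)" using Y Z s t w unfolding cut_def by blast
        moreover have "Y \<inter> Z \<subset> Y" using w Z by blast
        ultimately show False using smaller by blast
      next
        case True
        have "parcs G `` (Y - Z - {w}) \<subseteq> insert w (Y - Z - {w})"
          using Y Z True arc_commute by blast
        moreover have "t \<in> Y" using t st True by blast
        ultimately have "cut w (Y - Z - {w})"
          using Y Z s t w wt unfolding cut_def by blast
        moreover have "Y - Z - {w} \<subset> Y" using w by blast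
        ultimately show False using smaller by blast
      qed
    qed
    obtain w where w: "w \<in> Y" "(x, w) \<in> parcs G" using less.prems by (auto simp: cut_def)
    \<comment> \<open>An edge from \<open>w\<close> to another vertex of \<open>Y\<close> would have
      a cut vertex as an end, contrary to \<open>inside\<close>. Hence \<open>w\<close> is a
      leaf.\<close>
    have "parcs G `` {w} \<subseteq> {x}"
    proof
      fix u assume "u \<in> parcs G `` {w}"
      then have wu: "(w, u) \<in> parcs G" by blast
      then have "u \<notin> Y" using edge_transitive_cut[OF et less.prems wu] inside w by blast
      then show "u \<in> {x}" using wu w Y by blast
    qed
    then show False using edge_transitive_leaf[OF et w(2) _ bc] b c by blast
  qed
qed

lemma edge_transitive_no_sep:
  assumes et: "edge_transitive G" and no_cut: "\<And>x Y. \<not> cut x Y" and xy: "(x, y) \<in> parcs G"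
  shows "\<not> sep x y K"
proof
  assume "sep x y K"
  have fin: "finite K" if "sep x y K" for x y K
    using that finite_subset[OF _ pair_finite_verts] by (simp add: sep_def)
  from \<open>sep x y K\<close> xy show False
  proof (induction "card K" arbitrary: x y K rule: less_induct)
    case less
    have K: "K \<subseteq> pverts G" "x \<notin> K" "y \<notin> K" "parcs G `` K \<subseteq> insert x (insert y K)"
      using less.prems by (auto simp: sep_def)
    have xy: "x \<noteq> y" using less.prems arc_distinct by blast
    obtain z where z: "z \<in> K" "(x, z) \<in> parcs G" using less.prems by (auto simp: sep_def)
    have smaller: False if "sep z x M" "M \<subset> K" for M
      using less.hyps that z(2) fin[OF less.prems(1)] psubset_card_mono arc_commute by blast
    obtain L where sep: "sep x z L" using edge_transitive_sep[OF et] less.prems z by blast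
    then have L: "x \<notin> L" "z \<notin> L" "parcs G `` L \<subseteq> insert x (insert z L)"
      by (auto simp: sep_def)
    obtain s where s: "(z, s) \<in> parcs G" "s \<in> L" using sep by (auto simp: sep_def)
    obtain t where t: "(z, t) \<in> parcs G" "t \<notin> L" "t \<noteq> x" using sep by (auto simp: sep_def)
    have zx: "(z, x) \<in> parcs G" using z arc_commute by blast
    \<comment> \<open>The neighbours of \<open>z\<close> other than \<open>x\<close> lie in
      \<open>K\<close> or equal \<open>y\<close>. So whichever of \<open>s\<close> and
      \<open>t\<close> is on the side avoiding \<open>y\<close> lies in \<open>K\<close>.\<close>
    have st: "s \<in> insert y K" "t \<in> insert y K" "t \<noteq> z" using s t K L z arc_distinct by blast+
    show False
    proof (cases "y \<in> L")
      case False
      obtain r where r: "(x, r) \<in> parcs G" "r \<notin> insert z L" using sep by (auto simp: sep_def)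
      have "parcs G `` (K \<inter> L) \<subseteq> insert z (insert x (K \<inter> L))"
        using K L z False by blast
      then have "sep z x (K \<inter> L)"
        using K L s st r z False by (intro sep_of_no_cut[OF no_cut zx]) blast+
      then show False using smaller[of "K \<inter> L"] z L by blast
    next
      case True
      have "parcs G `` (K - L - {z}) \<subseteq> insert z (insert x (K - L - {z}))"
        using K L z True arc_commute by blast
      \<comment> \<open>The neighbour of \<open>x\<close> on the far side is now \<open>y\<close>
        itself.\<close>
      moreover have "\<not> parcs G `` {x} \<subseteq> insert z (K - L - {z})"
        using less.prems(2) z K by blast
      moreover have "t \<in> K - L - {z}" using st t True by blast
      ultimately have "sep z x (K - L - {z})"
        using K L t by (intro sep_of_no_cut[OF no_cut zx]) blast+
      then show False using smaller[of "K - L - {z}"] z by blast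
    qed
  qed
qed

section \<open>Closing the path to a cycle\<close>

text \<open>The path \<open>q\<close> runs from \<open>d\<close> back to \<open>a\<close>, so that
  it can be appended to the path \<open>a\<close>, \<open>b\<close>, \<open>c\<close>,
  \<open>d\<close>.\<close>

lemma apath_avoiding:
  assumes et: "edge_transitive G"
    and arcs: "(a, b) \<in> parcs G" "(b, c) \<in> parcs G" "(c, d) \<in> parcs G"
    and ne: "distinct [a, b, c, d]"
  obtains q where "apath d q a" "b \<notin> set (pawalk_verts d q)" "c \<notin> set (pawalk_verts d q)"
proof -
  \<comment> \<open>The component of \<open>d\<close> after deletion of \<open>b\<close> and
    \<open>c\<close>.\<close>
  define K where "K = {w. \<exists>q. awalk d q w \<and> b \<notin> set (pawalk_verts d q) \<and> c \<notin> set (pawalk_verts d q)}"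
  \<comment> \<open>The neighbours \<open>a\<close> of \<open>b\<close> and \<open>d\<close> of
    \<open>c\<close> show that neither \<open>b\<close> nor \<open>c\<close> is a leaf.\<close>
  have no_cut: "\<not> cut x Y" for x Y
    using arcs ne arc_commute by (intro edge_transitive_no_cut[OF et arcs(2)]) auto
  have cb: "(c, b) \<in> parcs G" and ba: "(b, a) \<in> parcs G" using arcs arc_commute by blast+
  have V: "K \<subseteq> pverts G" unfolding K_def using awalk_last_in_verts by blast
  have end_mem: "w \<in> set (pawalk_verts d q)" if "awalk d q w" for q w
    using last_in_set[OF awalk_verts_non_Nil[of d q]] awalkE[OF that] by metis
  then have bcK: "b \<notin> K" "c \<notin> K" by (auto simp: K_def)
  have "awalk d [] d" using arcs wellformed' by (auto simp: awalk_Nil_iff)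
  then have dK: "d \<in> K" unfolding K_def using ne by force
  have "parcs G `` K \<subseteq> insert c (insert b K)"
  proof
    fix t assume "t \<in> parcs G `` K"
    then obtain w where w: "w \<in> K" and wt: "(w, t) \<in> parcs G" by blast
    obtain q where q: "awalk d q w" "b \<notin> set (pawalk_verts d q)" "c \<notin> set (pawalk_verts d q)"
      using w by (auto simp: K_def)
    have e: "awalk w [(w, t)] t" using arc_implies_awalk[OF wt] by simp
    have "awalk d (q @ [(w, t)]) t" using q(1) e by (rule awalk_appendI)
    moreover have "set (pawalk_verts d (q @ [(w, t)])) = insert t (set (pawalk_verts d q))"
      unfolding set_awalk_verts_append[OF q(1) e] using end_mem[OF q(1)] by auto
    ultimately have "t \<in> K" if "t \<noteq> c" "t \<noteq> b"
      unfolding K_def using that q(2,3) by (intro CollectI exI[of _ "q @ [(w, t)]"]) simp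
    then show "t \<in> insert c (insert b K)" by blast
  qed
  \<comment> \<open>The neighbour of \<open>c\<close> in \<open>K\<close> is \<open>d\<close>. Since
    \<open>sep c b K\<close> is impossible, every neighbour of \<open>b\<close> except
    \<open>c\<close> is in \<open>K\<close>, in particular \<open>a\<close>.\<close>
  then have "sep c b K" if "\<not> parcs G `` {b} \<subseteq> insert c K"
    using that dK arcs(3) bcK by (intro sep_of_no_cut[OF no_cut cb V]) auto
  then have "parcs G `` {b} \<subseteq> insert c K"
    using edge_transitive_no_sep[OF et no_cut cb] by metis
  then have "a \<in> K" using ba ne by auto
  then obtain q where q: "awalk d q a" "b \<notin> set (pawalk_verts d q)" "c \<notin> set (pawalk_verts d q)"
    by (auto simp: K_def)
  let ?r = "awalk_to_apath q"
  have r: "apath d ?r a" using q(1) by (rule apath_awalk_to_apath)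
  then have "awalk d ?r a" by (simp add: apath_def)
  \<comment> \<open>Shortening to a path keeps only arcs of \<open>q\<close>, so \<open>b\<close>
    and \<open>c\<close> are still avoided.\<close>
  moreover have "set ?r \<subseteq> set q" using q(1) by (rule awalk_to_apath_subset)
  ultimately have "set (pawalk_verts d ?r) \<subseteq> set (pawalk_verts d q)"
    unfolding set_awalk_verts[OF q(1)] by (simp add: set_awalk_verts) blast
  with q r that show ?thesis by blast
qed

end

theorem corollary7p2:
  fixes G :: "'a pair_pre_digraph" and p :: "('a \<times> 'a) awalk" and u v :: 'a
  assumes "pair_graph G"
    and "pverts G \<noteq> {}"
    and "edge_transitive G"
    and "pre_digraph.apath (with_proj G) u p v"
    and "length p = 3"
  shows "closes_to_cycle G u p"
proof -
  interpret pair_graph G by fact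
  obtain e1 e2 e3 where p: "p = [e1, e2, e3]"
    using assms(5) by (auto simp: numeral_3_eq_3 length_Suc_conv)
  obtain b c where bc: "e1 = (u, b)" "e2 = (b, c)" "e3 = (c, v)"
    using assms(4) p by (cases e1; cases e2; cases e3) (auto simp: apath_simps)
  have arcs: "(u, b) \<in> parcs G" "(b, c) \<in> parcs G" "(c, v) \<in> parcs G"
    and ne: "distinct [u, b, c, v]"
    using assms(4) by (auto simp: p bc apath_simps)
  obtain q where q: "apath v q u" "b \<notin> set (pawalk_verts v q)" "c \<notin> set (pawalk_verts v q)"
    using apath_avoiding[OF assms(3) arcs ne] .
  have "awalk u (p @ q) u"
    using assms(4) q(1) by (auto simp: apath_def intro: awalk_appendI)
  \<comment> \<open>A cycle needs distinct vertices after the first is dropped; the start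
    \<open>u\<close> is still counted as the last vertex of \<open>q\<close>.\<close>
  moreover have "tl (pawalk_verts u (p @ q)) = b # c # pawalk_verts v q"
    using q(1) by (cases q) (auto simp: p bc apath_simps)
  ultimately have "cycle (p @ q)"
    using q ne by (auto simp: cycle_def apath_def p)
  \<comment> \<open>The arcs of \<open>p\<close> have tails \<open>u\<close>, \<open>b\<close>,
    \<open>c\<close> only. As \<open>u\<close> and \<open>v\<close> differ, \<open>q\<close> is
    nonempty and its first arc has tail \<open>v\<close>.\<close>
  moreover have "v \<in> fst ` set q"
    using q(1) ne by (cases q) (auto simp: apath_simps)
  ultimately show ?thesis
    unfolding closes_to_cycle_def und_cycle_def
    by (intro exI[of _ "p @ q"]) (auto simp: p bc und_edges_def)
qed

end
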